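(* Let $P$ (prompts), $S$ (contracts), $C$ (artifacts), $O$ (observations) be sets with equivalence relations $R_P,R_S,R_C,R_O$. Consider a pipeline of one of the following two forms: (i) (untagged) kernels $\mathsf{Front}:P\to\mathcal{D}(S)$, $\mathsf{Gen}:S\to\mathcal{D}(C)$, $\mathsf{Obs}:C\to\mathcal{D}(O)$, with end-to-end kernel $\Pi=\mathsf{Front};\mathsf{Gen};\mathsf{Obs}$; (ii) (contract-tagged) kernels $\mathsf{Front}:P\to\mathcal{D}(S)$, $\mathsf{Gen}:S\to\mathcal{D}(C)$, $\mathsf{Obs}:S\times C\to\mathcal{D}(O)$, with end-to-end kernel $\Pi=\mathsf{Front};\widehat{\mathsf{Gen}};\mathsf{Obs}$, where $\widehat{\mathsf{Gen}}:S\to\mathcal{D}(S\times C)$ is $\widehat{\mathsf{Gen}}(s)(s',c)=\mathsf{Gen}(s)(c)$ if $s'=s$ and $0$ otherwise, and $S\times C$ carries the product equivalence. Suppose every layer of the pipeline is compatible with the equivalences at its input and output interfaces. Let $p,p'\in P$ induce equivalent contract distributions, i.e. $\mathsf{Front}(p)\,\overline{R_S}\,\mathsf{Front}(p')$. Then $\Pi(p)(E)=\Pi(p')(E)$ for every class $E\in O/R_O$. Hence every $R_O$-closed event $A\subseteq O$ (for instance, a commit event that is $R_O$-closed) satisfies $\Pi(p)(A)=\Pi(p')(A)$.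
   Context: For a set $X$, $\mathcal{D}(X)$ denotes the set of finitely supported probability distributions on $X$. A kernel from $X$ to $Y$ is a function $K:X\to\mathcal{D}(Y)$; its affine extension is $K^{\dagger}(\mu)(y)=\sum_x\mu(x)K(x)(y)$, and sequential composition with $L:Y\to\mathcal{D}(Z)$ is $(K;L)(x)=L^{\dagger}(K(x))$. For an equivalence relation $R$ on $Y$ and $\mu,\nu\in\mathcal{D}(Y)$, write $\mu\,\overline{R}\,\nu$ iff $\mu(E)=\nu(E)$ for every class $E\in Y/R$. A kernel $K:X\to\mathcal{D}(Y)$ is $(R_X,R_Y)$-compatible when $x\,R_X\,x'$ implies $K(x)\,\overline{R_Y}\,K(x')$. The product equivalence on $S\times C$ relates $(s,c)$ and $(s',c')$ iff $s\,R_S\,s'$ and $c\,R_C\,c'$. An event $A\subseteq O$ is $R_O$-closed (equivalence-closed) if it is a union of $R_O$-classes. *)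

theory Defs
  imports "HOL-Probability.Probability"
begin

text \<open>
  The sets of the development are carrier sets, and an equivalence relation on a carrier \<open>X\<close>
  is a relation \<open>R\<close> with \<open>equiv X R\<close>. A kernel from \<open>X\<close> to \<open>Y\<close> is an element of
  \<open>X \<rightarrow> findist Y\<close>, its values outside \<open>X\<close> being irrelevant.
\<close>

definition findist :: "'a set \<Rightarrow> 'a pmf set" where
  "findist X = {\<mu>. finite (set_pmf \<mu>) \<and> set_pmf \<mu> \<subseteq> X}"

definition affine_ext :: "('a \<Rightarrow> 'b pmf) \<Rightarrow> 'a pmf \<Rightarrow> 'b pmf" where
  "affine_ext K \<mu> = bind_pmf \<mu> K"

lemma pmf_affine_ext:
  assumes "\<mu> \<in> findist X"
  shows "pmf (affine_ext K \<mu>) y = (\<Sum>x\<in>set_pmf \<mu>. pmf \<mu> x * pmf (K x) y)"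
  using assms unfolding affine_ext_def findist_def pmf_bind
  by (subst integral_measure_pmf_real[of "set_pmf \<mu>"]) (auto simp: mult.commute)

definition kernel_seq :: "('a \<Rightarrow> 'b pmf) \<Rightarrow> ('b \<Rightarrow> 'c pmf) \<Rightarrow> 'a \<Rightarrow> 'c pmf"
    (infixl "\<^bold>;" 55) where
  "(K \<^bold>; L) x = affine_ext L (K x)"

lemma kernel_seq_in:
  assumes "K \<in> X \<rightarrow> findist Y" "L \<in> Y \<rightarrow> findist Z"
  shows "K \<^bold>; L \<in> X \<rightarrow> findist Z"
  using assms by (fastforce simp: kernel_seq_def affine_ext_def findist_def Pi_iff)

definition lifted_equiv :: "'a set \<Rightarrow> ('a \<times> 'a) set \<Rightarrow> 'a pmf \<Rightarrow> 'a pmf \<Rightarrow> bool" where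
  "lifted_equiv Y R \<mu> \<nu> \<longleftrightarrow>
     (\<forall>E\<in>Y // R. measure_pmf.prob \<mu> E = measure_pmf.prob \<nu> E)"

definition compatible ::
    "('a \<times> 'a) set \<Rightarrow> 'b set \<Rightarrow> ('b \<times> 'b) set \<Rightarrow> ('a \<Rightarrow> 'b pmf) \<Rightarrow> bool" where
  "compatible R\<^sub>X Y R\<^sub>Y K \<longleftrightarrow>
     (\<forall>x x'. (x, x') \<in> R\<^sub>X \<longrightarrow> lifted_equiv Y R\<^sub>Y (K x) (K x'))"

definition prod_equiv ::
    "('a \<times> 'a) set \<Rightarrow> ('b \<times> 'b) set \<Rightarrow> (('a \<times> 'b) \<times> ('a \<times> 'b)) set" where
  "prod_equiv R R' = {((s, c), (s', c')). (s, s') \<in> R \<and> (c, c') \<in> R'}"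

lemma equiv_prod_equiv:
  assumes "equiv X R" "equiv Y R'"
  shows "equiv (X \<times> Y) (prod_equiv R R')"
proof (rule equivI)
  show "prod_equiv R R' \<subseteq> (X \<times> Y) \<times> (X \<times> Y)"
    using assms by (auto simp: prod_equiv_def equiv_def)
  show "refl_on (X \<times> Y) (prod_equiv R R')"
    using assms by (auto simp: prod_equiv_def equiv_def refl_on_def)
  show "sym (prod_equiv R R')"
    using assms by (auto simp: prod_equiv_def equiv_def sym_def)
  show "trans (prod_equiv R R')"
    using assms unfolding prod_equiv_def equiv_def trans_def by blast
qed

definition tagged :: "('s \<Rightarrow> 'c pmf) \<Rightarrow> 's \<Rightarrow> ('s \<times> 'c) pmf" where
  "tagged Gen s = map_pmf (Pair s) (Gen s)"

lemma pmf_tagged: "pmf (tagged Gen s) (s', c) = (if s' = s then pmf (Gen s) c else 0)"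
proof (cases "s' = s")
  case True
  then show ?thesis
    by (simp add: tagged_def pmf_map_inj' inj_on_def)
next
  case False
  then show ?thesis
    by (auto simp: tagged_def pmf_eq_0_set_pmf)
qed

definition equiv_closed :: "'a set \<Rightarrow> ('a \<times> 'a) set \<Rightarrow> 'a set \<Rightarrow> bool" where
  "equiv_closed Y R A \<longleftrightarrow> (\<exists>\<U>. \<U> \<subseteq> Y // R \<and> A = \<Union>\<U>)"

end

theory Submission
  imports Defs
begin

text \<open>
  Two distributions supported in \<open>Y\<close> are related by the lifting of \<open>R\<close> iff their push-forwards
  along the quotient map \<open>y \<mapsto> R `` {y}\<close> coincide. A compatible kernel, followed by the quotient
  map of its target, factors through the quotient map of its source; hence its affine extension
  preserves lifted equivalence, which is then propagated layer by layer. The tagging kernel is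
  compatible because the product class of a tagged artifact is determined by the class of the
  contract and the class of the artifact.
\<close>

text \<open>Inside \<open>Y\<close>, a class \<open>E\<close> is exactly the fibre over the point
  \<open>E\<close> of the quotient map. This turns class probabilities into point masses of a
  push-forward.\<close>

lemma mem_quotient_class_iff:
  assumes "equiv Y R" "E \<in> Y // R" "y \<in> Y"
  shows "y \<in> E \<longleftrightarrow> R `` {y} = E"
proof -
  obtain x where x: "x \<in> Y" "E = R `` {x}"
    using assms(2) by (rule quotientE)
  have "y \<in> E \<longleftrightarrow> (x, y) \<in> R"
    using x by simp
  also have "\<dots> \<longleftrightarrow> R `` {x} = R `` {y}"
    using assms(1) x(1) assms(3) by (simp add: eq_equiv_class_iff)
  finally show ?thesis
    using x(2) by auto
qed

text \<open>The probability of a class is the point mass of the push-forward at that class: the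
  class and the fibre agree on \<open>Y\<close>, hence almost surely for a distribution supported in
  \<open>Y\<close>.\<close>

lemma lifted_equivI_map_pmf:
  assumes "equiv Y R" "set_pmf \<mu> \<subseteq> Y" "set_pmf \<nu> \<subseteq> Y"
    and "map_pmf (\<lambda>y. R `` {y}) \<mu> = map_pmf (\<lambda>y. R `` {y}) \<nu>"
  shows "lifted_equiv Y R \<mu> \<nu>"
  unfolding lifted_equiv_def
proof
  fix E assume E: "E \<in> Y // R"
  have class_iff: "y \<in> E \<longleftrightarrow> R `` {y} = E" if "y \<in> Y" for y
    using assms(1) E that by (rule mem_quotient_class_iff)
  have "measure_pmf.prob \<xi> E = pmf (map_pmf (\<lambda>y. R `` {y}) \<xi>) E" if "set_pmf \<xi> \<subseteq> Y" for \<xi>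
    unfolding pmf_map using class_iff that by (intro measure_pmf.finite_measure_eq_AE)
      (auto simp: AE_measure_pmf_iff)
  then show "measure_pmf.prob \<mu> E = measure_pmf.prob \<nu> E"
    using assms by simp
qed

lemma lifted_equivD_map_pmf:
  assumes "equiv Y R" "set_pmf \<mu> \<subseteq> Y" "set_pmf \<nu> \<subseteq> Y" "lifted_equiv Y R \<mu> \<nu>"
  shows "map_pmf (\<lambda>y. R `` {y}) \<mu> = map_pmf (\<lambda>y. R `` {y}) \<nu>"
proof (rule pmf_eqI)
  fix E
  show "pmf (map_pmf (\<lambda>y. R `` {y}) \<mu>) E = pmf (map_pmf (\<lambda>y. R `` {y}) \<nu>) E"
  proof (cases "E \<in> Y // R")
    case True
    have class_iff: "y \<in> E \<longleftrightarrow> R `` {y} = E" if "y \<in> Y" for y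
      using assms(1) True that by (rule mem_quotient_class_iff)
    have "pmf (map_pmf (\<lambda>y. R `` {y}) \<xi>) E = measure_pmf.prob \<xi> E" if "set_pmf \<xi> \<subseteq> Y" for \<xi>
      unfolding pmf_map using class_iff that by (intro measure_pmf.finite_measure_eq_AE)
        (auto simp: AE_measure_pmf_iff)
    then show ?thesis
      using assms True by (simp add: lifted_equiv_def)
  next
    case False
    \<comment> \<open>Points of \<open>Y\<close> are sent to elements of \<open>Y // R\<close>, so a
      push-forward has no mass at any other set \<open>E\<close>.\<close>
    have "pmf (map_pmf (\<lambda>y. R `` {y}) \<xi>) E = 0" if "set_pmf \<xi> \<subseteq> Y" for \<xi>
      using False that by (auto simp: pmf_eq_0_set_pmf intro: quotientI)
    then show ?thesis
      using assms by simp
  qed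
qed

text \<open>Modulo \<open>R\<^sub>Z\<close>, the distribution \<open>L y\<close> depends only on the
  class of \<open>y\<close>. The push-forward of \<open>affine_ext L \<mu>\<close> is therefore a
  function of the push-forward of \<open>\<mu>\<close>.\<close>

lemma lifted_equiv_affine_ext:
  assumes Y: "equiv Y R\<^sub>Y" and Z: "equiv Z R\<^sub>Z"
    and L: "L \<in> Y \<rightarrow> findist Z" "compatible R\<^sub>Y Z R\<^sub>Z L"
    and \<mu>: "set_pmf \<mu> \<subseteq> Y" and \<nu>: "set_pmf \<nu> \<subseteq> Y" and eq: "lifted_equiv Y R\<^sub>Y \<mu> \<nu>"
  shows "lifted_equiv Z R\<^sub>Z (affine_ext L \<mu>) (affine_ext L \<nu>)"
proof (rule lifted_equivI_map_pmf[OF Z])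
  have supp: "set_pmf (L y) \<subseteq> Z" if "y \<in> Y" for y
    using L(1) that by (auto simp: findist_def)
  show "set_pmf (affine_ext L \<mu>) \<subseteq> Z" "set_pmf (affine_ext L \<nu>) \<subseteq> Z"
    using supp \<mu> \<nu> by (auto simp: affine_ext_def)
  \<comment> \<open>\<open>h\<close> is the kernel induced on classes, read off at a chosen
    representative; compatibility of \<open>L\<close> makes the choice immaterial.\<close>
  define h where "h E = map_pmf (\<lambda>z. R\<^sub>Z `` {z}) (L (SOME y. y \<in> E))" for E
  have h: "map_pmf (\<lambda>z. R\<^sub>Z `` {z}) (L y) = h (R\<^sub>Y `` {y})" if "y \<in> Y" for y
  proof -
    have "y \<in> R\<^sub>Y `` {y}"
      using Y that by (rule equiv_class_self)
    then have rel: "(y, SOME y'. y' \<in> R\<^sub>Y `` {y}) \<in> R\<^sub>Y"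
      by (metis Image_singleton_iff someI)
    \<comment> \<open>The representative has to lie in \<open>Y\<close>, because only there is
      \<open>L\<close> known to be supported in \<open>Z\<close>.\<close>
    then have "(SOME y'. y' \<in> R\<^sub>Y `` {y}) \<in> Y"
      using Y by (auto simp: equiv_def)
    then show ?thesis
      unfolding h_def using L(2) rel that
      by (intro lifted_equivD_map_pmf[OF Z]) (auto simp: compatible_def dest: supp[THEN subsetD])
  qed
  have factor: "map_pmf (\<lambda>z. R\<^sub>Z `` {z}) (affine_ext L \<xi>) = bind_pmf (map_pmf (\<lambda>y. R\<^sub>Y `` {y}) \<xi>) h"
    if "set_pmf \<xi> \<subseteq> Y" for \<xi>
    unfolding affine_ext_def map_bind_pmf bind_map_pmf
    using h that by (intro bind_pmf_cong) auto
  show "map_pmf (\<lambda>z. R\<^sub>Z `` {z}) (affine_ext L \<mu>) = map_pmf (\<lambda>z. R\<^sub>Z `` {z}) (affine_ext L \<nu>)"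
    using factor \<mu> \<nu> lifted_equivD_map_pmf[OF Y \<mu> \<nu> eq] by simp
qed

lemma tagged_in:
  assumes "Gen \<in> S \<rightarrow> findist C"
  shows "tagged Gen \<in> S \<rightarrow> findist (S \<times> C)"
proof
  fix s assume "s \<in> S"
  with assms have "Gen s \<in> findist C"
    by (rule funcset_mem)
  with \<open>s \<in> S\<close> show "tagged Gen s \<in> findist (S \<times> C)"
    by (auto simp: tagged_def findist_def)
qed

text \<open>A product class is the rectangle of its two component classes. Equivalent contracts
  share the first side, and compatibility of \<open>Gen\<close> equates the distributions of the
  second.\<close>

lemma compatible_tagged:
  assumes S: "equiv S R\<^sub>S" and C: "equiv C R\<^sub>C"
    and Gen: "Gen \<in> S \<rightarrow> findist C" "compatible R\<^sub>S C R\<^sub>C Gen"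
  shows "compatible R\<^sub>S (S \<times> C) (prod_equiv R\<^sub>S R\<^sub>C) (tagged Gen)"
  unfolding compatible_def
proof (intro allI impI)
  fix s s' assume rel: "(s, s') \<in> R\<^sub>S"
  then have mem: "s \<in> S" "s' \<in> S"
    using S by (auto simp: equiv_def)
  have Gen_supp: "set_pmf (Gen t) \<subseteq> C" if "t \<in> S" for t
    using Gen(1) that by (auto simp: findist_def)
  have tagged_supp: "set_pmf (tagged Gen t) \<subseteq> S \<times> C" if "t \<in> S" for t
    using tagged_in[OF Gen(1)] that by (auto simp: findist_def)
  have prod_class: "prod_equiv R\<^sub>S R\<^sub>C `` {(t, c)} = R\<^sub>S `` {t} \<times> R\<^sub>C `` {c}" for t c
    by (auto simp: prod_equiv_def)
  have factor: "map_pmf (\<lambda>x. prod_equiv R\<^sub>S R\<^sub>C `` {x}) (tagged Gen t) =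
      map_pmf (\<lambda>E. R\<^sub>S `` {t} \<times> E) (map_pmf (\<lambda>c. R\<^sub>C `` {c}) (Gen t))" for t
    by (simp add: tagged_def pmf.map_comp o_def prod_class)
  have "map_pmf (\<lambda>c. R\<^sub>C `` {c}) (Gen s) = map_pmf (\<lambda>c. R\<^sub>C `` {c}) (Gen s')"
    using C Gen_supp mem Gen(2) rel by (intro lifted_equivD_map_pmf) (auto simp: compatible_def)
  moreover have "R\<^sub>S `` {s} = R\<^sub>S `` {s'}"
    using S rel by (rule equiv_class_eq)
  ultimately show "lifted_equiv (S \<times> C) (prod_equiv R\<^sub>S R\<^sub>C) (tagged Gen s) (tagged Gen s')"
    by (intro lifted_equivI_map_pmf equiv_prod_equiv S C tagged_supp mem) (simp only: factor)
qed

text \<open>Within \<open>Y\<close>, a closed event is the preimage of the family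
  \<open>\<U>\<close> under the quotient map. Comparing push-forwards on \<open>\<U>\<close> avoids
  summing over classes, of which there may be uncountably many.\<close>

lemma prob_equiv_closed_eq:
  assumes Y: "equiv Y R" and \<mu>: "set_pmf \<mu> \<subseteq> Y" and \<nu>: "set_pmf \<nu> \<subseteq> Y"
    and eq: "lifted_equiv Y R \<mu> \<nu>" and A: "equiv_closed Y R A"
  shows "measure_pmf.prob \<mu> A = measure_pmf.prob \<nu> A"
proof -
  obtain \<U> where \<U>: "\<U> \<subseteq> Y // R" "A = \<Union>\<U>"
    using A by (auto simp: equiv_closed_def)
  have mem_iff: "y \<in> A \<longleftrightarrow> R `` {y} \<in> \<U>" if "y \<in> Y" for y
  proof
    assume "y \<in> A"
    then obtain E where "E \<in> \<U>" "y \<in> E"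
      using \<U>(2) by blast
    moreover from this have "R `` {y} = E"
      using \<U>(1) that by (subst mem_quotient_class_iff[OF Y, symmetric]) auto
    ultimately show "R `` {y} \<in> \<U>"
      by simp
  next
    assume "R `` {y} \<in> \<U>"
    then show "y \<in> A"
      using \<U>(2) equiv_class_self[OF Y that] by blast
  qed
  have "measure_pmf.prob \<xi> A = measure_pmf.prob (map_pmf (\<lambda>y. R `` {y}) \<xi>) \<U>"
    if "set_pmf \<xi> \<subseteq> Y" for \<xi>
    unfolding measure_map_pmf using mem_iff that by (intro measure_pmf.finite_measure_eq_AE)
      (auto simp: AE_measure_pmf_iff)
  then show ?thesis
    using \<mu> \<nu> lifted_equivD_map_pmf[OF Y \<mu> \<nu> eq] by (simp del: measure_map_pmf)
qed

text \<open>Equivalence is assumed at the single pair \<open>x\<close>, \<open>x'\<close> and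
  returned at the same pair, so the lemma can be iterated along the pipeline from the assumption on
  \<open>Front p\<close> and \<open>Front p'\<close>.\<close>

lemma lifted_equiv_kernel_seq:
  assumes "equiv Y R\<^sub>Y" "equiv Z R\<^sub>Z" "K \<in> X \<rightarrow> findist Y"
    and "L \<in> Y \<rightarrow> findist Z" "compatible R\<^sub>Y Z R\<^sub>Z L"
    and "x \<in> X" "x' \<in> X" "lifted_equiv Y R\<^sub>Y (K x) (K x')"
  shows "lifted_equiv Z R\<^sub>Z ((K \<^bold>; L) x) ((K \<^bold>; L) x')"
  unfolding kernel_seq_def
  using assms by (intro lifted_equiv_affine_ext[of Y R\<^sub>Y Z R\<^sub>Z]) (auto simp: findist_def Pi_iff)

theorem corollary1:
  fixes P :: "'p set" and S :: "'s set" and C :: "'c set" and Ob :: "'o set"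
    and R\<^sub>P :: "('p \<times> 'p) set" and R\<^sub>S :: "('s \<times> 's) set"
    and R\<^sub>C :: "('c \<times> 'c) set" and R\<^sub>O :: "('o \<times> 'o) set"
    and Front :: "'p \<Rightarrow> 's pmf" and Gen :: "'s \<Rightarrow> 'c pmf" and EndToEnd :: "'p \<Rightarrow> 'o pmf"
    and p p' :: 'p
  assumes "equiv P R\<^sub>P" and "equiv S R\<^sub>S" and "equiv C R\<^sub>C" and "equiv Ob R\<^sub>O"
    and "Front \<in> P \<rightarrow> findist S" and "compatible R\<^sub>P S R\<^sub>S Front"
    and "Gen \<in> S \<rightarrow> findist C" and "compatible R\<^sub>S C R\<^sub>C Gen"
    and pipeline:
      "(\<exists>Obs :: 'c \<Rightarrow> 'o pmf.
          Obs \<in> C \<rightarrow> findist Ob \<and> compatible R\<^sub>C Ob R\<^sub>O Obs \<and>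
          EndToEnd = Front \<^bold>; Gen \<^bold>; Obs) \<or>
       (\<exists>Obs :: 's \<times> 'c \<Rightarrow> 'o pmf.
          Obs \<in> S \<times> C \<rightarrow> findist Ob \<and> compatible (prod_equiv R\<^sub>S R\<^sub>C) Ob R\<^sub>O Obs \<and>
          EndToEnd = Front \<^bold>; tagged Gen \<^bold>; Obs)"
    and "p \<in> P" and "p' \<in> P"
    and "lifted_equiv S R\<^sub>S (Front p) (Front p')"
  shows "(\<forall>E\<in>Ob // R\<^sub>O. measure_pmf.prob (EndToEnd p) E = measure_pmf.prob (EndToEnd p') E) \<and>
         (\<forall>A. equiv_closed Ob R\<^sub>O A \<longrightarrow>
            measure_pmf.prob (EndToEnd p) A = measure_pmf.prob (EndToEnd p') A)"
proof -
  note S = assms(2) and C = assms(3) and Ob = assms(4)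
  note Front = assms(5) and Gen = assms(7,8) and mem = assms(10,11) and eq = assms(12)
  \<comment> \<open>The typing of \<open>EndToEnd\<close> is carried along because the passage from
    classes to closed events uses supports contained in \<open>Ob\<close>.\<close>
  have "EndToEnd \<in> P \<rightarrow> findist Ob \<and> lifted_equiv Ob R\<^sub>O (EndToEnd p) (EndToEnd p')"
    using pipeline
  proof (elim disjE exE conjE)
    fix Obs :: "'c \<Rightarrow> 'o pmf"
    assume Obs: "Obs \<in> C \<rightarrow> findist Ob" "compatible R\<^sub>C Ob R\<^sub>O Obs"
      and EndToEnd: "EndToEnd = Front \<^bold>; Gen \<^bold>; Obs"
    have FG: "Front \<^bold>; Gen \<in> P \<rightarrow> findist C"
      using Front Gen(1) by (rule kernel_seq_in)
    have "lifted_equiv C R\<^sub>C ((Front \<^bold>; Gen) p) ((Front \<^bold>; Gen) p')"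
      by (rule lifted_equiv_kernel_seq[OF S C Front Gen mem eq])
    from lifted_equiv_kernel_seq[OF C Ob FG Obs mem this] kernel_seq_in[OF FG Obs(1)]
    show ?thesis
      by (simp add: EndToEnd)
  next
    fix Obs :: "'s \<times> 'c \<Rightarrow> 'o pmf"
    assume Obs: "Obs \<in> S \<times> C \<rightarrow> findist Ob" "compatible (prod_equiv R\<^sub>S R\<^sub>C) Ob R\<^sub>O Obs"
      and EndToEnd: "EndToEnd = Front \<^bold>; tagged Gen \<^bold>; Obs"
    \<comment> \<open>The tagged form runs the same two-step propagation, with
      \<open>S \<times> C\<close> and its product equivalence as the middle interface.\<close>
    note SC = equiv_prod_equiv[OF S C]
    have FG: "Front \<^bold>; tagged Gen \<in> P \<rightarrow> findist (S \<times> C)"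
      using Front tagged_in[OF Gen(1)] by (rule kernel_seq_in)
    have "lifted_equiv (S \<times> C) (prod_equiv R\<^sub>S R\<^sub>C) ((Front \<^bold>; tagged Gen) p) ((Front \<^bold>; tagged Gen) p')"
      by (rule lifted_equiv_kernel_seq[OF S SC Front tagged_in[OF Gen(1)]
            compatible_tagged[OF S C Gen] mem eq])
    from lifted_equiv_kernel_seq[OF SC Ob FG Obs mem this] kernel_seq_in[OF FG Obs(1)]
    show ?thesis
      by (simp add: EndToEnd)
  qed
  then have kernel: "EndToEnd \<in> P \<rightarrow> findist Ob"
    and end_eq: "lifted_equiv Ob R\<^sub>O (EndToEnd p) (EndToEnd p')"
    by simp_all
  have "set_pmf (EndToEnd p) \<subseteq> Ob" "set_pmf (EndToEnd p') \<subseteq> Ob"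
    using kernel mem by (auto simp: findist_def)
  from prob_equiv_closed_eq[OF Ob this end_eq] end_eq show ?thesis
    unfolding lifted_equiv_def by blast
qed

end
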